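(* For every integer $n\geq 4$, the pancake graph $P_n$ is hyper-connected; that is, for every minimum vertex cut $D$ of $P_n$, the graph $P_n-D$ has exactly two connected components, one of which is an isolated vertex.
   Context: For $n\ge 2$ and $2\leq j\leq n$, let $r_{1j}\in S_n$ be the prefix reversal, i.e. the permutation of $\{1,\dots,n\}$ with $r_{1j}(k)=j+1-k$ for $1\leq k\leq j$ and $r_{1j}(k)=k$ for $j<k\leq n$. Let $PR_n=\{r_{1j}: 2\leq j\leq n\}$. The pancake graph $P_n$ is the Cayley graph $\mathrm{Cay}(S_n,PR_n)$: the simple undirected graph with vertex set the symmetric group $S_n$ and edges $\{g,gs\}$ for $g\in S_n$, $s\in PR_n$, where products of permutations are composed as $(gs)(k)=g(s(k))$. A graph $X$ is hyper-connected if for every minimum vertex cut $D$ of $X$ (a vertex set of minimum cardinality whose removal disconnects $X$), $X-D$ has exactly two components, one of which is an isolated vertex. *)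

theory Defs
  imports "HOL-Algebra.Sym_Groups" "Graph_Theory.Graph_Theory"
begin

text \<open>
  As in \<^theory>\<open>Graph_Theory.Digraph\<close>, an undirected graph is a symmetric digraph: the edge
  \<open>{g, g s}\<close> is the pair of arcs \<open>(g, g s)\<close> and \<open>(g s, g)\<close>. It is simple (loop-free) as soon as
  \<open>S\<close> does not contain the identity.
\<close>

definition cayley_graph :: "('a, 'm) monoid_scheme \<Rightarrow> 'a set \<Rightarrow> ('a, 'a \<times> 'a) pre_digraph" where
  "cayley_graph G S = with_proj
     \<lparr> pverts = carrier G,
       parcs = (\<Union>g\<in>carrier G. \<Union>s\<in>S. {(g, g \<otimes>\<^bsub>G\<^esub> s), (g \<otimes>\<^bsub>G\<^esub> s, g)}) \<rparr>"

definition prefix_reversal :: "nat \<Rightarrow> nat \<Rightarrow> nat" where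
  "prefix_reversal j k = (if 1 \<le> k \<and> k \<le> j then j + 1 - k else k)"

definition prefix_reversals :: "nat \<Rightarrow> (nat \<Rightarrow> nat) set" where
  "prefix_reversals n = {prefix_reversal j | j. 2 \<le> j \<and> j \<le> n}"

text \<open>
  The carrier of \<^term>\<open>sym_group n\<close> consists of the functions on \<^typ>\<open>nat\<close> that permute
  \<^term>\<open>{1..n}\<close> and fix everything else; its product is \<^term>\<open>(\<circ>)\<close>, so \<open>(g s)(k) = g (s k)\<close>.
\<close>

definition pancake_graph :: "nat \<Rightarrow> (nat \<Rightarrow> nat, (nat \<Rightarrow> nat) \<times> (nat \<Rightarrow> nat)) pre_digraph" where
  "pancake_graph n = cayley_graph (sym_group n) (prefix_reversals n)"

definition delete_verts :: "('a, 'b) pre_digraph \<Rightarrow> 'a set \<Rightarrow> ('a, 'b) pre_digraph" where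
  "delete_verts X D = X \<restriction> (verts X - D)"

definition components :: "('a, 'b) pre_digraph \<Rightarrow> ('a, 'b) pre_digraph set" where
  "components X = {C. pre_digraph.max_subgraph X Digraph_Component.connected C}"

text \<open>
  The null graph is not \<^const>\<open>Digraph_Component.connected\<close>, so deleting all vertices
  has to be excluded explicitly.
\<close>

definition vertex_cut :: "('a, 'b) pre_digraph \<Rightarrow> 'a set \<Rightarrow> bool" where
  "vertex_cut X D \<longleftrightarrow> D \<subseteq> verts X \<and> verts (delete_verts X D) \<noteq> {} \<and>
     \<not> Digraph_Component.connected (delete_verts X D)"

text \<open>Meant for finite graphs only: \<^const>\<open>card\<close> is 0 on infinite sets.\<close>

definition min_vertex_cut :: "('a, 'b) pre_digraph \<Rightarrow> 'a set \<Rightarrow> bool" where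
  "min_vertex_cut X D \<longleftrightarrow> vertex_cut X D \<and> (\<forall>D'. vertex_cut X D' \<longrightarrow> card D \<le> card D')"

text \<open>In a loop-free graph a component with a single vertex is an isolated vertex.\<close>

definition hyper_connected :: "('a, 'b) pre_digraph \<Rightarrow> bool" where
  "hyper_connected X \<longleftrightarrow>
     (\<forall>D. min_vertex_cut X D \<longrightarrow>
        card (components (delete_verts X D)) = 2 \<and>
        (\<exists>C \<in> components (delete_verts X D). \<exists>v. verts C = {v}))"

lemma prefix_reversal_involution: "prefix_reversal j (prefix_reversal j k) = k"
  by (auto simp: prefix_reversal_def)

lemma prefix_reversal_permutes:
  assumes "j \<le> n"
  shows "prefix_reversal j permutes {1..n}"
proof -
  have "\<exists>!k. prefix_reversal j k = i" for i
    by (metis prefix_reversal_involution)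
  moreover have "prefix_reversal j k = k" if "k \<notin> {1..n}" for k
    using that assms by (auto simp: prefix_reversal_def)
  ultimately show ?thesis
    by (simp add: permutes_def)
qed

lemma id_notin_prefix_reversals: "id \<notin> prefix_reversals n"
proof
  assume "id \<in> prefix_reversals n"
  then obtain j where "2 \<le> j" "prefix_reversal j = id"
    by (auto simp: prefix_reversals_def)
  from fun_cong[OF this(2), of 1] this(1) show False
    by (simp add: prefix_reversal_def)
qed

lemma graph_pancake_graph: "graph (pancake_graph n)"
proof -
  let ?P = "\<lparr> pverts = carrier (sym_group n),
       parcs = (\<Union>g\<in>carrier (sym_group n). \<Union>s\<in>prefix_reversals n.
         {(g, g \<otimes>\<^bsub>sym_group n\<^esub> s), (g \<otimes>\<^bsub>sym_group n\<^esub> s, g)}) \<rparr>"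
  have fin: "finite (carrier (sym_group n))"
    by (simp add: sym_group_def finite_permutations)
  have gs: "g \<otimes>\<^bsub>sym_group n\<^esub> s \<in> carrier (sym_group n)" "g \<otimes>\<^bsub>sym_group n\<^esub> s \<noteq> g"
    if "g \<in> carrier (sym_group n)" "s \<in> prefix_reversals n" for g s
  proof -
    have "s permutes {1..n}"
      using that(2) prefix_reversal_permutes unfolding prefix_reversals_def by blast
    then show "g \<otimes>\<^bsub>sym_group n\<^esub> s \<in> carrier (sym_group n)"
      using that(1) by (simp add: sym_group_def permutes_compose)
    have "inj g"
      using that(1) by (simp add: sym_group_def permutes_inj)
    moreover have "s \<noteq> id"
      using that(2) id_notin_prefix_reversals by auto
    ultimately show "g \<otimes>\<^bsub>sym_group n\<^esub> s \<noteq> g"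
      by (auto simp: sym_group_def fun_eq_iff inj_eq)
  qed
  have sub: "parcs ?P \<subseteq> carrier (sym_group n) \<times> carrier (sym_group n)"
    using gs(1) by auto
  have fin': "finite (parcs ?P)"
    by (rule finite_subset[OF sub]) (simp add: fin)
  have "pair_graph ?P"
  proof
    fix e assume e: "e \<in> parcs ?P"
    show "fst e \<in> pverts ?P" "snd e \<in> pverts ?P"
      using subsetD[OF sub e] by auto
    from e obtain g s where gs': "g \<in> carrier (sym_group n)" "s \<in> prefix_reversals n"
      and "e = (g, g \<otimes>\<^bsub>sym_group n\<^esub> s) \<or> e = (g \<otimes>\<^bsub>sym_group n\<^esub> s, g)"
      by auto
    then show "fst e \<noteq> snd e"
      using gs(2)[OF gs'] by auto
  next
    show "finite (pverts ?P)" using fin by simp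
    show "finite (parcs ?P)" by (fact fin')
    show "symmetric ?P"
      unfolding symmetric_def sym_def by simp blast
  qed
  then show ?thesis
    unfolding pancake_graph_def cayley_graph_def by (rule pair_graph.pair_graphD_graph)
qed

end

theory Submission
  imports Defs
begin

text \<open>
  The cosets of \<open>S\<^sub>n\<^sub>-\<^sub>1\<close> split \<open>P\<^sub>n\<close> into \<open>n\<close> copies of \<open>P\<^sub>n\<^sub>-\<^sub>1\<close>; any two copies are joined by
  \<open>(n - 2)!\<close> edges, and every vertex lies on exactly one such cross edge. Delete a set \<open>D\<close>. If every
  copy contains so few deleted vertices that it stays connected, then the surviving cross edges
  connect the copies, through a third copy if necessary. Otherwise almost all of \<open>D\<close> lies in a
  single copy, the other copies stay connected to one another, and a vertex of the bad copy can be
  cut off from them only if its cross neighbour is deleted. Hence, by induction,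
  \<open>card D \<le> n - 2\<close> leaves \<open>P\<^sub>n\<close> connected; and for \<open>n \<ge> 4\<close>, \<open>card D \<le> n - 1\<close> leaves all
  vertices but at most one in a single component. The neighbours of the identity show that minimum
  cuts have at most \<open>n - 1\<close> elements.
\<close>

section \<open>Cosets of the standard parabolic subgroups\<close>

text \<open>Left cosets suit a graph whose edges multiply on the right: reversals of length at most
  \<open>m\<close> keep a vertex inside its coset.\<close>

definition sym_coset :: "nat \<Rightarrow> (nat \<Rightarrow> nat) \<Rightarrow> (nat \<Rightarrow> nat) set" where
  "sym_coset m h = {h \<circ> s | s. s permutes {1..m}}"

lemma sym_coset_self: "h \<in> sym_coset m h"
  unfolding sym_coset_def using permutes_id by (metis (mono_tags, lifting) comp_id mem_Collect_eq)

lemma sym_coset_id: "sym_coset n id = {p. p permutes {1..n}}"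
  by (auto simp: sym_coset_def)

lemma sym_coset_subset:
  assumes "g \<in> sym_coset k h" "m \<le> k"
  shows "sym_coset m g \<subseteq> sym_coset k h"
proof
  fix x assume "x \<in> sym_coset m g"
  then obtain s where s: "x = g \<circ> s" "s permutes {1..m}" by (auto simp: sym_coset_def)
  obtain t where t: "g = h \<circ> t" "t permutes {1..k}" using assms by (auto simp: sym_coset_def)
  have "s permutes {1..k}" using s(2) assms(2) by (auto intro: permutes_subset)
  then have "t \<circ> s permutes {1..k}" using t by (auto intro: permutes_compose)
  then show "x \<in> sym_coset k h" using s t by (auto simp: sym_coset_def comp_assoc)
qed

lemma sym_coset_permutes:
  assumes "h permutes {1..n}" "m \<le> n" "x \<in> sym_coset m h"
  shows "x permutes {1..n}"
  using sym_coset_subset[of h n id m] assms by (auto simp: sym_coset_id)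

lemma sym_coset_inj:
  assumes "x \<in> sym_coset m h" "inj h"
  shows "inj x"
  using assms by (auto simp: sym_coset_def intro: inj_compose permutes_inj)

lemma sym_coset_image:
  assumes "x \<in> sym_coset m h" "i \<in> {1..m}"
  shows "x i \<in> h ` {1..m}"
proof -
  obtain s where "x = h \<circ> s" "s permutes {1..m}" using assms by (auto simp: sym_coset_def)
  then show ?thesis using permutes_in_image[of s "{1..m}" i] assms(2) by auto
qed

lemma sym_coset_last:
  assumes "x \<in> sym_coset m g"
  shows "x (Suc m) = g (Suc m)"
proof -
  obtain s where "x = g \<circ> s" "s permutes {1..m}" using assms by (auto simp: sym_coset_def)
  then show ?thesis using permutes_not_in[of s "{1..m}" "Suc m"] by auto
qed

text \<open>Two elements of the coset differ by a right factor from
  \<open>S\<^sub>m\<^sub>+\<^sub>1\<close>; it lies in \<open>S\<^sub>m\<close> exactly if it fixes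
  \<open>Suc m\<close>, that is, if the two agree there.\<close>

lemma sym_coset_block:
  assumes h: "inj h" and g: "g \<in> sym_coset (Suc m) h"
  shows "sym_coset m g = {x \<in> sym_coset (Suc m) h. x (Suc m) = g (Suc m)}"
proof (intro equalityI subsetI)
  fix x assume "x \<in> sym_coset m g"
  then show "x \<in> {x \<in> sym_coset (Suc m) h. x (Suc m) = g (Suc m)}"
    using sym_coset_subset[OF g, of m] sym_coset_last by auto
next
  fix x assume x: "x \<in> {x \<in> sym_coset (Suc m) h. x (Suc m) = g (Suc m)}"
  obtain t where t: "g = h \<circ> t" "t permutes {1..Suc m}" using g by (auto simp: sym_coset_def)
  obtain s where s: "x = h \<circ> s" "s permutes {1..Suc m}" using x by (auto simp: sym_coset_def)
  have st: "s (Suc m) = t (Suc m)" using x s t h by (auto simp: inj_eq)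
  define u where "u = inv_into UNIV t \<circ> s"
  have u: "u permutes {1..Suc m}" unfolding u_def
    using s t by (auto intro: permutes_compose permutes_inv)
  have "u (Suc m) = Suc m" unfolding u_def using st permutes_inverses(2)[OF t(2)] by simp
  then have "u permutes {1..m}"
    by (intro permutes_superset[OF u]) (auto simp: le_Suc_eq)
  moreover have "g \<circ> u = x" unfolding u_def s t
    using permutes_inv_o(1)[OF t(2)] by (metis comp_assoc comp_id)
  ultimately show "x \<in> sym_coset m g" by (auto simp: sym_coset_def)
qed

section \<open>Prefix reversals and the edges between blocks\<close>

lemma prefix_reversal_ends:
  assumes "1 \<le> k"
  shows "prefix_reversal k k = 1" "prefix_reversal k 1 = k"
  using assms by (auto simp: prefix_reversal_def)

lemma comp_prefix_reversal_twice: "(x \<circ> prefix_reversal k) \<circ> prefix_reversal k = x"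
  by (simp add: fun_eq_iff prefix_reversal_involution)

lemma sym_coset_comp_prefix_reversal:
  assumes "x \<in> sym_coset m h"
  shows "x \<circ> prefix_reversal m \<in> sym_coset m h"
proof -
  have "x \<circ> prefix_reversal m \<in> sym_coset m x"
    using prefix_reversal_permutes[of m m] by (auto simp: sym_coset_def)
  then show ?thesis using sym_coset_subset[OF assms, of m] by auto
qed

text \<open>
  By \<open>sym_coset_block\<close>, the coset \<open>h S\<^sub>k\<close> is split into copies of \<open>S\<^sub>k\<^sub>-\<^sub>1\<close> by the value at \<open>k\<close>,
  and \<open>x \<mapsto> x r\<^sub>1\<^sub>k\<close> swaps the values at \<open>1\<close> and \<open>k\<close>: the set counted here consists of the
  endpoints in block \<open>a\<close> of the edges between the blocks \<open>a\<close> and \<open>b\<close>.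
\<close>
lemma card_cross_edges:
  assumes h: "inj h" and k: "2 \<le> k" and a: "a \<in> h ` {1..k}" and b: "b \<in> h ` {1..k}" and "a \<noteq> b"
  shows "fact (k - 2) \<le> card {x \<in> sym_coset k h. x k = a \<and> x 1 = b}"
proof -
  obtain a' b' where a': "a = h a'" "a' \<in> {1..k}" and b': "b = h b'" "b' \<in> {1..k}"
    using a b by auto
  have ne: "a' \<noteq> b'" using a' b' \<open>a \<noteq> b\<close> by auto
  \<comment> \<open>The witness \<open>g\<close> is \<open>h\<close> with \<open>a\<close> brought
    to position \<open>k\<close> by \<open>t\<close> and then \<open>b\<close> to position 1; as
    \<open>c \<noteq> k\<close>, the second swap keeps \<open>a\<close> in place.\<close>
  define t where "t = Transposition.transpose k a'"
  define c where "c = t b'"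
  define g where "g = h \<circ> (t \<circ> Transposition.transpose 1 c)"
  have t: "t permutes {1..k}" unfolding t_def using a' by (auto intro: permutes_swap_id)
  have c: "c \<in> {1..k}" "c \<noteq> k" "t c = b'" unfolding c_def
    using permutes_in_image[OF t] b' ne unfolding t_def
    by (auto simp: Transposition.transpose_def)
  have tc: "Transposition.transpose 1 c permutes {1..k}"
    using c k by (auto intro!: permutes_swap_id)
  have g: "g \<in> sym_coset k h" unfolding g_def sym_coset_def
    using permutes_compose[OF tc t] by blast
  have gk: "g k = a" unfolding g_def using c k a' by (auto simp: Transposition.transpose_def t_def)
  have g1: "g 1 = b" unfolding g_def using c b' by (auto simp: Transposition.transpose_def)
  have ginj: "inj g" using sym_coset_inj[OF g h] .
  \<comment> \<open>Rearranging the middle positions leaves both end values of \<open>g\<close>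
    alone.\<close>
  let ?P = "{s. s permutes {2..k - 1}}"
  have sub: "(\<lambda>s. g \<circ> s) ` ?P \<subseteq> {x \<in> sym_coset k h. x k = a \<and> x 1 = b}"
  proof
    fix x assume "x \<in> (\<lambda>s. g \<circ> s) ` ?P"
    then obtain s where s: "x = g \<circ> s" "s permutes {2..k - 1}" by auto
    have "s permutes {1..k}" using s(2) by (rule permutes_subset) auto
    then have "x \<in> sym_coset k g" using s by (auto simp: sym_coset_def)
    then have "x \<in> sym_coset k h" using sym_coset_subset[OF g, of k] by auto
    moreover have "s k = k" "s 1 = 1" using permutes_not_in[OF s(2)] k by auto
    ultimately show "x \<in> {x \<in> sym_coset k h. x k = a \<and> x 1 = b}" using s gk g1 by auto
  qed
  have "inj_on (\<lambda>s. g \<circ> s) ?P" using ginj by (auto intro!: inj_onI simp: fun_eq_iff inj_eq)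
  then have "card ((\<lambda>s. g \<circ> s) ` ?P) = card ?P" by (rule card_image)
  also have "\<dots> = fact (k - 2)" using card_permutations[of "{2..k-1}" "k - 2"] k by auto
  finally have eq: "card ((\<lambda>s. g \<circ> s) ` ?P) = fact (k - 2)" .
  have "finite (sym_coset k h)"
    using finite_permutations[of "{1..k}"] by (auto simp: sym_coset_def)
  then have "finite {x \<in> sym_coset k h. x k = a \<and> x 1 = b}" by auto
  from card_mono[OF this sub] eq show ?thesis by simp
qed

section \<open>Pancake graphs with some vertices deleted\<close>

lemma verts_pancake_graph: "verts (pancake_graph n) = {p. p permutes {1..n}}"
  by (simp add: pancake_graph_def cayley_graph_def sym_group_def)

lemma arcs_ends_pancake_graph:
  "arcs_ends (pancake_graph n) =
     {(x, x \<circ> prefix_reversal j) | x j. x permutes {1..n} \<and> 2 \<le> j \<and> j \<le> n}"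
proof -
  \<comment> \<open>The reverse arc of an edge is a step by the same reversal, which is an
    involution.\<close>
  have *: "(g \<circ> prefix_reversal j, g) \<in> {(x, x \<circ> prefix_reversal j) | x j. x permutes {1..n} \<and> 2 \<le> j \<and> j \<le> n}"
    if "g permutes {1..n}" "2 \<le> j" "j \<le> n" for g j
    using that permutes_compose[OF prefix_reversal_permutes[of j n] that(1)]
      comp_prefix_reversal_twice[of g j, symmetric] by blast
  show ?thesis
    using * by (auto simp: pancake_graph_def cayley_graph_def sym_group_def arcs_ends_conv
      prefix_reversals_def)
qed

lemma arcs_ends_induce_subgraph: "arcs_ends (G \<restriction> S) = arcs_ends G \<inter> S \<times> S"
  by (auto simp: arcs_ends_conv)

locale pancake_deletion =
  fixes n :: nat and D :: "(nat \<Rightarrow> nat) set"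
  assumes finite_D: "finite D"
begin

abbreviation G where "G \<equiv> delete_verts (pancake_graph n) D"

lemma verts_G: "verts G = {p. p permutes {1..n}} - D"
  by (simp add: delete_verts_def verts_pancake_graph)

lemma sym_digraph_G: "sym_digraph G"
proof -
  interpret P: graph "pancake_graph n" by (rule graph_pancake_graph)
  show ?thesis unfolding delete_verts_def
    by (rule P.induced_graph_imp_graph[OF P.induced_induce]) auto
qed

sublocale sym_digraph G by (rule sym_digraph_G)

lemma reachable_step:
  assumes "x permutes {1..n}" "2 \<le> k" "k \<le> n" "x \<notin> D" "x \<circ> prefix_reversal k \<notin> D"
  shows "x \<rightarrow>\<^sup>*\<^bsub>G\<^esub> (x \<circ> prefix_reversal k)"
proof -
  have "x \<circ> prefix_reversal k permutes {1..n}"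
    using assms by (intro permutes_compose prefix_reversal_permutes)
  then have "(x, x \<circ> prefix_reversal k) \<in> arcs_ends G"
    using assms unfolding delete_verts_def arcs_ends_induce_subgraph
    by (auto simp: arcs_ends_pancake_graph verts_pancake_graph)
  then show ?thesis by blast
qed

text \<open>Paths may leave \<open>S\<close>, so linked sets can be chained through surviving cross
  edges.\<close>

definition linked :: "(nat \<Rightarrow> nat) set \<Rightarrow> bool" where
  "linked S \<longleftrightarrow> (\<forall>x \<in> S - D. \<forall>y \<in> S - D. x \<rightarrow>\<^sup>*\<^bsub>G\<^esub> y)"

lemma linkedD: "linked S \<Longrightarrow> x \<in> S \<Longrightarrow> x \<notin> D \<Longrightarrow> y \<in> S \<Longrightarrow> y \<notin> D \<Longrightarrow> x \<rightarrow>\<^sup>*\<^bsub>G\<^esub> y"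
  by (auto simp: linked_def)

end

section \<open>A single coset and its blocks\<close>

locale pancake_coset = pancake_deletion +
  fixes k :: nat and h :: "nat \<Rightarrow> nat"
  assumes h_permutes: "h permutes {1..n}" and k_ge: "2 \<le> k" and k_le: "k \<le> n"
begin

abbreviation A where "A \<equiv> sym_coset k h"
abbreviation block where "block a \<equiv> {x \<in> A. x k = a}"
abbreviation flip where "flip x \<equiv> x \<circ> prefix_reversal k"

lemma h_inj: "inj h"
  using h_permutes by (rule permutes_inj)

lemma flip_in_A: "x \<in> A \<Longrightarrow> flip x \<in> A"
  by (rule sym_coset_comp_prefix_reversal)

lemma flip_ends: "flip x k = x 1" "flip x 1 = x k"
  using prefix_reversal_ends[of k] k_ge by auto

lemma flip_flip: "flip (flip x) = x"
  by (rule comp_prefix_reversal_twice)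

lemma ends_differ: "x \<in> A \<Longrightarrow> x 1 \<noteq> x k"
  using sym_coset_inj[OF _ h_inj, of x k] k_ge inj_eq[of x 1 k] by auto

lemma flip_reachable:
  assumes "x \<in> A" "x \<notin> D" "flip x \<notin> D"
  shows "x \<rightarrow>\<^sup>*\<^bsub>G\<^esub> flip x"
  using assms sym_coset_permutes[OF h_permutes k_le] reachable_step k_ge k_le by auto

text \<open>The cross edges are pairwise disjoint. If each had a deleted endpoint, picking one per
  edge would give at least \<open>fact (k - 2)\<close> deleted vertices.\<close>

lemma surviving_cross_edge:
  assumes ab: "a \<in> h ` {1..k}" "b \<in> h ` {1..k}" "a \<noteq> b"
    and few: "card {x \<in> D \<inter> A. {x k, x 1} = {a, b}} < fact (k - 2)"
  obtains x where "x \<in> A" "x \<notin> D" "flip x \<notin> D" "x k = a" "x 1 = b"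
proof (rule ccontr)
  assume neg: "\<not> thesis"
  let ?X = "{x \<in> A. x k = a \<and> x 1 = b}"
  let ?f = "\<lambda>x. if x \<in> D then x else flip x"
  have sub: "?f ` ?X \<subseteq> {x \<in> D \<inter> A. {x k, x 1} = {a, b}}"
    using neg that flip_in_A flip_ends by (auto simp del: comp_apply)
  have inj: "inj_on ?f ?X"
  proof (rule inj_onI)
    fix x y assume xy: "x \<in> ?X" "y \<in> ?X" "?f x = ?f y"
    \<comment> \<open>The value at \<open>k\<close> reveals which endpoint was picked:
      \<open>a\<close> for \<open>x\<close> itself, \<open>b\<close> for
      \<open>flip x\<close>.\<close>
    have "?f x k = ?f y k" using xy(3) by simp
    then have "x \<in> D \<longleftrightarrow> y \<in> D" using xy(1,2) ab(3) flip_ends(1)[of x] flip_ends(1)[of y]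
      by (auto split: if_splits)
    then show "x = y"
    proof (cases "x \<in> D")
      case False
      then have "flip x = flip y" using xy(3) \<open>x \<in> D \<longleftrightarrow> y \<in> D\<close> by simp
      then have "flip (flip x) = flip (flip y)" by (rule arg_cong)
      then show ?thesis unfolding flip_flip .
    qed (use xy(3) in simp)
  qed
  have "card ?X \<le> card {x \<in> D \<inter> A. {x k, x 1} = {a, b}}"
    by (rule card_inj_on_le[OF inj sub]) (use finite_D in simp)
  then show False using card_cross_edges[OF h_inj k_ge ab] few by linarith
qed

lemma reachable_across:
  assumes blocks: "linked (block a)" "linked (block b)"
    and few: "a \<noteq> b \<Longrightarrow> card {x \<in> D \<inter> A. {x k, x 1} = {a, b}} < fact (k - 2)"
    and x: "x \<in> A" "x \<notin> D" "x k = a" and y: "y \<in> A" "y \<notin> D" "y k = b"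
  shows "x \<rightarrow>\<^sup>*\<^bsub>G\<^esub> y"
proof (cases "a = b")
  case True
  then show ?thesis using blocks x y by (auto intro: linkedD)
next
  case False
  have "k \<in> {1..k}" using k_ge by auto
  then have "a \<in> h ` {1..k}" "b \<in> h ` {1..k}" using x y sym_coset_image by auto
  then obtain z where z: "z \<in> A" "z \<notin> D" "flip z \<notin> D" "z k = a" "z 1 = b"
    using surviving_cross_edge[OF _ _ False few[OF False]] by blast
  have "x \<rightarrow>\<^sup>*\<^bsub>G\<^esub> z" using linkedD[OF blocks(1), of x z] x z by auto
  also have "z \<rightarrow>\<^sup>*\<^bsub>G\<^esub> flip z" using flip_reachable z by auto
  also have "flip z \<rightarrow>\<^sup>*\<^bsub>G\<^esub> y"
    using linkedD[OF blocks(2), of "flip z" y] y z flip_in_A[OF z(1)] flip_ends(1)[of z] by auto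
  finally show ?thesis .
qed

text \<open>
  A deleted vertex lies on a single cross edge. Separating block \<open>a\<close> from block \<open>b\<close> directly
  thus uses up half of the available deletions, so that a third block \<open>c\<close> cannot be separated from
  \<open>a\<close> or \<open>b\<close> as well.
\<close>
lemma linked_light:
  assumes blocks: "\<And>a. linked (block a)" and k3: "3 \<le> k"
    and few: "card (D \<inter> A) < 2 * fact (k - 2)"
  shows "linked A"
  unfolding linked_def
proof (intro ballI)
  fix x y assume xy: "x \<in> A - D" "y \<in> A - D"
  \<comment> \<open>The unordered pair collects deleted endpoints on both sides; different pairs of
    blocks give disjoint sets.\<close>
  let ?E = "\<lambda>a b. {x \<in> D \<inter> A. {x k, x 1} = {a, b}}"
  have disj: "card (?E a b) < fact (k - 2) \<or> card (?E c d) < fact (k - 2)"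
    if "{a, b} \<noteq> {c, d}" for a b c d
  proof -
    have "?E a b \<inter> ?E c d = {}" using that by blast
    moreover have "finite (?E a b)" "finite (?E c d)" using finite_D by simp_all
    ultimately have "card (?E a b) + card (?E c d) = card (?E a b \<union> ?E c d)"
      by (simp add: card_Un_disjoint)
    also have "\<dots> \<le> card (D \<inter> A)" using finite_D by (intro card_mono) auto
    finally show ?thesis using few by linarith
  qed
  show "x \<rightarrow>\<^sup>*\<^bsub>G\<^esub> y"
  proof (cases "x k = y k \<or> card (?E (x k) (y k)) < fact (k - 2)")
    case True
    then show ?thesis using reachable_across[OF blocks blocks, of "x k" "y k" x y] xy by auto
  next
    case False
    have "card {x k, y k} < card (h ` {1..k})"
      using False k3 card_image[OF inj_on_subset[OF h_inj], of "{1..k}"] by auto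
    then obtain c where c: "c \<in> h ` {1..k}" "c \<notin> {x k, y k}"
      by (metis card_mono finite.emptyI finite.insertI leD subsetI)
    have 1: "card (?E (x k) c) < fact (k - 2)"
      using disj[of "x k" "y k" "x k" c] False c by (auto simp: doubleton_eq_iff)
    have 2: "card (?E c (y k)) < fact (k - 2)"
      using disj[of "x k" "y k" c "y k"] False c by (auto simp: doubleton_eq_iff)
    have "x k \<in> h ` {1..k}" using xy sym_coset_image[of x k h k] k_ge by auto
    then obtain z where z: "z \<in> A" "z \<notin> D" "flip z \<notin> D" "z k = x k" "z 1 = c"
      using surviving_cross_edge[of "x k" c] 1 c by auto
    have fz: "flip z \<in> A" "flip z k = c" using z flip_in_A flip_ends(1)[of z] by auto
    have "x \<rightarrow>\<^sup>*\<^bsub>G\<^esub> flip z"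
      using reachable_across[OF blocks blocks, of "x k" c x "flip z"] 1 fz z xy by auto
    also have "flip z \<rightarrow>\<^sup>*\<^bsub>G\<^esub> y"
      using reachable_across[OF blocks blocks, of c "y k" "flip z" y] 2 fz z xy by auto
    finally show ?thesis .
  qed
qed

text \<open>Too few vertices are deleted outside block \<open>e\<close> to separate two other
  blocks, and a vertex of block \<open>e\<close> reaches them along its own cross edge. Nothing is
  assumed about connectivity within block \<open>e\<close>.\<close>

lemma linked_heavy:
  assumes blocks: "\<And>a. a \<noteq> e \<Longrightarrow> linked (block a)"
    and few: "card (D \<inter> A - block e) < fact (k - 2)"
  shows "linked {x \<in> A. x k = e \<longrightarrow> flip x \<notin> D}"
proof -
  have out: "x \<rightarrow>\<^sup>*\<^bsub>G\<^esub> y"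
    if "x \<in> A" "x \<notin> D" "x k \<noteq> e" "y \<in> A" "y \<notin> D" "y k \<noteq> e" for x y
  proof (rule reachable_across[OF blocks blocks])
    have "card {z \<in> D \<inter> A. {z k, z 1} = {x k, y k}} \<le> card (D \<inter> A - block e)"
      using that finite_D by (intro card_mono) (auto simp: doubleton_eq_iff)
    then show "card {z \<in> D \<inter> A. {z k, z 1} = {x k, y k}} < fact (k - 2)"
      using few by linarith
  qed (use that in auto)
  have escape: "\<exists>z. x \<rightarrow>\<^sup>*\<^bsub>G\<^esub> z \<and> z \<in> A \<and> z \<notin> D \<and> z k \<noteq> e"
    if "x \<in> A" "x \<notin> D" "x k = e \<longrightarrow> flip x \<notin> D" for x
  proof (cases "x k = e")
    case True
    then show ?thesis
      using that flip_reachable flip_in_A flip_ends(1)[of x] ends_differ[of x] by metis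
  next
    case False
    then show ?thesis using that out by metis
  qed
  show ?thesis unfolding linked_def
  proof (intro ballI)
    fix x y assume xy: "x \<in> {x \<in> A. x k = e \<longrightarrow> flip x \<notin> D} - D"
      "y \<in> {x \<in> A. x k = e \<longrightarrow> flip x \<notin> D} - D"
    obtain z w where z: "x \<rightarrow>\<^sup>*\<^bsub>G\<^esub> z" "z \<in> A" "z \<notin> D" "z k \<noteq> e"
      and w: "y \<rightarrow>\<^sup>*\<^bsub>G\<^esub> w" "w \<in> A" "w \<notin> D" "w k \<noteq> e"
      using escape[of x] escape[of y] xy by auto
    note z(1)
    also have "z \<rightarrow>\<^sup>*\<^bsub>G\<^esub> w" using out z w by auto
    also have "w \<rightarrow>\<^sup>*\<^bsub>G\<^esub> y" using w(1) by (rule symmetric_reachable')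
    finally show "x \<rightarrow>\<^sup>*\<^bsub>G\<^esub> y" .
  qed
qed

end

section \<open>Connectivity after few deletions\<close>

context pancake_deletion
begin

text \<open>Induction on \<open>m\<close>: either every block obeys the bound of the induction
  hypothesis, or one block holds all deletions and each of its vertices escapes along its cross
  edge.\<close>

lemma linked_sym_coset:
  assumes "2 \<le> m" "m \<le> n" "h permutes {1..n}" "card (D \<inter> sym_coset m h) \<le> m - 2"
  shows "linked (sym_coset m h)"
  using assms
proof (induction m arbitrary: h rule: nat_induct_at_least)
  case base
  then interpret pancake_coset n D 2 h by unfold_locales auto
  \<comment> \<open>A coset of \<open>S\<^sub>2\<close> is a single edge, and the bound
    \<open>2 - 2 = 0\<close> keeps both ends.\<close>
  have "{1..2::nat} = {1, 2}" by auto
  moreover have "prefix_reversal 2 = Transposition.transpose 1 2"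
    by (auto simp: prefix_reversal_def Transposition.transpose_def fun_eq_iff)
  ultimately have "{s. s permutes {1..2::nat}} = {id, prefix_reversal 2}"
    by (auto simp: permutes_doubleton_iff)
  moreover have "A = (\<circ>) h ` {s. s permutes {1..2}}" unfolding sym_coset_def by blast
  ultimately have A: "A = {h, flip h}" by simp
  have "h \<notin> D" "flip h \<notin> D" using base(3) finite_D A by auto
  moreover have "h \<in> verts G" "flip h \<in> verts G"
    using calculation h_permutes k_le sym_coset_permutes[of h n 2 "flip h"] A
    by (auto simp: verts_G)
  moreover have "h \<rightarrow>\<^sup>*\<^bsub>G\<^esub> flip h" using flip_reachable[of h] calculation A by auto
  ultimately show ?case unfolding linked_def A using symmetric_reachable' by auto
next
  case (Suc m)
  then interpret pancake_coset n D "Suc m" h by unfold_locales auto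
  have light: "linked (block a)" if "\<And>g. g \<in> block a \<Longrightarrow> card (D \<inter> sym_coset m g) \<le> m - 2" for a
  proof (cases "block a = {}")
    case False
    then obtain g where g: "g \<in> A" "g (Suc m) = a" by auto
    have eq: "sym_coset m g = block a" using sym_coset_block[OF h_inj g(1)] g(2) by simp
    have "g permutes {1..n}" using sym_coset_permutes[OF h_permutes k_le g(1)] .
    then show ?thesis using Suc.IH[of g] Suc.prems that[of g] g eq by auto
  qed (auto simp: linked_def)
  show ?case
  proof (cases "\<forall>g \<in> A. card (D \<inter> sym_coset m g) \<le> m - 2")
    case True
    have "m - 1 \<le> fact (m - 1)" by (rule fact_ge_self)
    moreover have "(0::nat) < fact (m - 1)" by simp
    ultimately have "card (D \<inter> A) < 2 * fact (m - 1)" using Suc.prems(3) by linarith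
    then show ?thesis using linked_light light True Suc.hyps by auto
  next
    case False
    then obtain g where g: "g \<in> A" "m - 1 \<le> card (D \<inter> sym_coset m g)" by auto
    have eq: "sym_coset m g = block (g (Suc m))" using sym_coset_block[OF h_inj g(1)] .
    \<comment> \<open>This block already contains \<open>m - 1 = Suc m - 2\<close> deletions, the
      whole allowance.\<close>
    have DA: "D \<inter> block (g (Suc m)) = D \<inter> A"
      using g(2) Suc.prems(3) finite_D unfolding eq
      by (intro card_seteq) auto
    have conc: "x (Suc m) = g (Suc m)" if "x \<in> D" "x \<in> A" for x
    proof -
      have "x \<in> D \<inter> block (g (Suc m))" using that unfolding DA by (rule IntI)
      then show ?thesis by simp
    qed
    have "linked {x \<in> A. x (Suc m) = g (Suc m) \<longrightarrow> flip x \<notin> D}"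
    proof (rule linked_heavy)
      fix a assume a: "a \<noteq> g (Suc m)"
      show "linked (block a)"
      proof (rule light)
        fix g' assume g': "g' \<in> block a"
        then have g'A: "g' \<in> A" and g'k: "g' (Suc m) = a" by auto
        have "sym_coset m g' = block a" using sym_coset_block[OF h_inj g'A] g'k by simp
        then have "D \<inter> sym_coset m g' = {}" using conc a by auto
        then show "card (D \<inter> sym_coset m g') \<le> m - 2" by simp
      qed
    next
      have "D \<inter> A - block (g (Suc m)) = {}" using conc by auto
      then show "card (D \<inter> A - block (g (Suc m))) < fact (Suc m - 2)"
        by (simp only: card.empty fact_gt_zero)
    qed
    \<comment> \<open>The cross neighbour lies in a block without deletions, so the set just linked
      is all of \<open>A\<close>.\<close>
    moreover have "flip x \<notin> D" if "x \<in> A" "x (Suc m) = g (Suc m)" for x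
    proof
      assume "flip x \<in> D"
      then have "flip x (Suc m) = g (Suc m)" using flip_in_A[OF that(1)] by (rule conc)
      then show False using flip_ends(1)[of x] ends_differ[OF that(1)] that(2) by simp
    qed
    ultimately show ?thesis by (simp add: linked_def)
  qed
qed

text \<open>This permits one deletion more than \<open>linked_sym_coset\<close> with
  \<open>m = n\<close>. A block exceeding its bound \<open>n - 3\<close> leaves at most one deletion
  outside, and only the vertex across from that one can be cut off.\<close>

lemma linked_except_one:
  assumes n: "4 \<le> n" and D: "card D \<le> n - 1"
  shows "\<exists>v. linked ({p. p permutes {1..n}} - {v})"
proof -
  interpret pancake_coset n D n id using n by unfold_locales auto
  have A: "A = {p. p permutes {1..n}}" by (rule sym_coset_id)
  have Sn: "Suc (n - 1) = n" using n by simp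
  have block_eq: "sym_coset (n - 1) g = block (g n)" if "g \<in> A" for g
    using sym_coset_block[OF h_inj, of g "n - 1"] that Sn by simp
  have light: "linked (block a)" if "card (D \<inter> block a) \<le> n - 3" for a
  proof (cases "block a = {}")
    case False
    then obtain g where g: "g \<in> A" "g n = a" by auto
    then show ?thesis
      using linked_sym_coset[of "n - 1" g] block_eq[OF g(1)] that n A by auto
  qed (auto simp: linked_def)
  have fact: "n - 2 \<le> fact (n - 2)" by (rule fact_ge_self)
  have DA: "card (D \<inter> A) \<le> n - 1"
    using D finite_D card_mono[of D "D \<inter> A"] by auto
  show ?thesis
  proof (cases "\<forall>a. card (D \<inter> block a) \<le> n - 3")
    case True
    \<comment> \<open>The inequality \<open>n - 1 < 2 * fact (n - 2)\<close> holds from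
      \<open>n = 4\<close> on but fails for \<open>n = 3\<close>.\<close>
    have "card (D \<inter> A) < 2 * fact (n - 2)" using DA fact n by linarith
    then have "linked A" using linked_light light True n by auto
    then show ?thesis unfolding A by (auto simp: linked_def)
  next
    case False
    then obtain e where "\<not> card (D \<inter> block e) \<le> n - 3" by blast
    then have e: "n - 2 \<le> card (D \<inter> block e)" using n by linarith
    have "D \<inter> A - block e = D \<inter> A - D \<inter> block e" "D \<inter> block e \<subseteq> D \<inter> A" by blast+
    then have "card (D \<inter> A - block e) = card (D \<inter> A) - card (D \<inter> block e)"
      using finite_D by (simp add: card_Diff_subset)
    then have one: "card (D \<inter> A - block e) \<le> 1" using e DA n by linarith
    \<comment> \<open>One deletion elsewhere stays within \<open>n - 3\<close> per block and below
      \<open>fact (n - 2)\<close>, again by \<open>n \<ge> 4\<close>.\<close>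
    have lk: "linked {x \<in> A. x n = e \<longrightarrow> flip x \<notin> D}"
    proof (rule linked_heavy)
      fix a assume "a \<noteq> e"
      then have "card (D \<inter> block a) \<le> card (D \<inter> A - block e)"
        using finite_D by (intro card_mono) auto
      then show "linked (block a)" using light one n by force
    next
      show "card (D \<inter> A - block e) < fact (n - 2)" using one fact n by linarith
    qed
    have bad: "flip x \<in> D \<inter> A - block e" if "x \<in> A" "x n = e" "flip x \<in> D" for x
    proof -
      have "flip x n \<noteq> e" using flip_ends(1)[of x] ends_differ[OF that(1)] that(2) by metis
      then show ?thesis using that(3) flip_in_A[OF that(1)] by blast
    qed
    have single: "p = q" if "p \<in> D \<inter> A - block e" "q \<in> D \<inter> A - block e" for p q
      using one finite_D card_le_Suc0_iff_eq[of "D \<inter> A - block e"] that by auto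
    \<comment> \<open>Both cross neighbours equal the only deletion outside block \<open>e\<close>,
      and \<open>flip\<close> is injective.\<close>
    have uniq: "x = y"
      if "x \<in> A" "x n = e" "flip x \<in> D" "y \<in> A" "y n = e" "flip y \<in> D" for x y
    proof -
      have "flip x = flip y" using single[OF bad[OF that(1-3)] bad[OF that(4-6)]] .
      then have "flip (flip x) = flip (flip y)" by (rule arg_cong)
      then show ?thesis unfolding flip_flip .
    qed
    have "\<exists>v. A - {v} \<subseteq> {x \<in> A. x n = e \<longrightarrow> flip x \<notin> D}"
    proof (cases "\<exists>v. v \<in> A \<and> v n = e \<and> flip v \<in> D")
      case True
      then obtain v where v: "v \<in> A" "v n = e" "flip v \<in> D" by auto
      show ?thesis using uniq[OF v] by (intro exI[of _ v]) auto
    next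
      case False
      then show ?thesis by auto
    qed
    then obtain v where v: "A - {v} \<subseteq> {x \<in> A. x n = e \<longrightarrow> flip x \<notin> D}" ..
    have "linked (A - {v})" unfolding linked_def
    proof (intro ballI)
      fix x y assume xy: "x \<in> A - {v} - D" "y \<in> A - {v} - D"
      show "x \<rightarrow>\<^sup>*\<^bsub>G\<^esub> y"
        by (rule linkedD[OF lk]) (use subsetD[OF v, of x] subsetD[OF v, of y] xy in simp_all)
    qed
    then show ?thesis unfolding A by (intro exI[of _ v])
  qed
qed

end

section \<open>Components and minimum cuts\<close>

lemma strongly_connected_imp_connected:
  assumes "wf_digraph G" "strongly_connected G"
  shows "Digraph_Component.connected G"
  using assms wf_digraph.reachable_mk_symmetricI[OF assms(1)]
  by (auto simp: Digraph_Component.connected_def strongly_connected_def)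

lemma arc_mono_connected: "arc_mono Digraph_Component.connected"
  unfolding arc_mono_def
  by (metis spanning_def subgraphE wf_digraph.connected_spanning_imp_connected)

text \<open>Induced subgraphs are again symmetric, so connected and strongly connected agree on
  them, and maximal connected subgraphs are induced. Components thus become reachability
  classes.\<close>

lemma components_symmetric:
  assumes "sym_digraph X"
  shows "components X = pre_digraph.sccs X"
proof -
  interpret sym_digraph X by fact
  have sc: "strongly_connected H \<longleftrightarrow> Digraph_Component.connected H" if "induced_subgraph H X" for H
  proof -
    interpret H: sym_digraph H using induced_graph_imp_graph[OF that] .
    show ?thesis
      using H.symmetric_connected_imp_strongly_connected H.sym_arcs
        strongly_connected_imp_connected H.wf_digraph by blast
  qed
  have conn: "Digraph_Component.connected y" if "strongly_connected y" "subgraph y X" for y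
    using that strongly_connected_imp_connected by blast
  have "max_subgraph strongly_connected H" if H: "max_subgraph Digraph_Component.connected H" for H
  proof (rule max_subgraphI)
    show "strongly_connected H"
      using sc[OF induced_subgraphI_arc_mono[OF H arc_mono_connected]] max_subgraph_prop[OF H]
      by simp
    show "subgraph H X" using H by (rule subgraphI_max_subgraph)
    fix y assume "H \<noteq> y" "subgraph H y" "subgraph y X"
    then show "\<not> strongly_connected y" using H conn unfolding max_subgraph_def by metis
  qed
  moreover have "max_subgraph Digraph_Component.connected H" if H: "max_subgraph strongly_connected H" for H
  proof (rule max_subgraphI)
    show "Digraph_Component.connected H"
      using H conn unfolding max_subgraph_def by metis
    show HX: "subgraph H X" using H by (rule subgraphI_max_subgraph)
    fix y assume y: "H \<noteq> y" "subgraph H y" "subgraph y X"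
    show "\<not> Digraph_Component.connected y"
    proof
      assume c: "Digraph_Component.connected y"
      \<comment> \<open>\<open>y\<close> may lack reverse arcs; on the induced subgraph its
        connectivity becomes strong, and the maximality of \<open>H\<close> applies.\<close>
      let ?Y = "X \<restriction> verts y"
      have ind: "induced_subgraph ?Y X" using y by (intro induced_induce) auto
      have sub: "subgraph y ?Y" using y(3) by (rule subgraph_induce_subgraphI2)
      have "Digraph_Component.connected ?Y"
        using arc_mono_connected[unfolded arc_mono_def, rule_format, of y ?Y] c sub by simp
      then have "strongly_connected ?Y" using sc[OF ind] by simp
      moreover have "subgraph H ?Y" using y(2) sub by (rule subgraph_trans)
      ultimately have "H = ?Y"
        using H ind unfolding max_subgraph_def induced_subgraph_def by metis
      then have "verts H = verts y" by simp
      have "subgraph y H" using sub \<open>H = ?Y\<close> by simp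
      then have "arcs H = arcs y" using y(2) by (auto simp: subgraph_def)
      then have "H = y" using \<open>verts H = verts y\<close> y(2)
        by (auto simp: subgraph_def compatible_def)
      then show False using y(1) by simp
    qed
  qed
  ultimately show ?thesis unfolding components_def sccs_altdef2 by blast
qed

section \<open>An upper bound for the size of minimum cuts\<close>

lemma prefix_reversal_inj_on: "inj_on prefix_reversal {2..n}"
proof (rule inj_onI)
  fix i j assume ij: "i \<in> {2..n}" "j \<in> {2..n}" and "prefix_reversal i = prefix_reversal j"
  then have "prefix_reversal i 1 = prefix_reversal j 1" by simp
  then show "i = j" using ij prefix_reversal_ends(2)[of i] prefix_reversal_ends(2)[of j] by simp
qed

lemma prefix_reversals_image: "prefix_reversals n = prefix_reversal ` {2..n}"
  by (auto simp: prefix_reversals_def)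

lemma card_prefix_reversals: "card (prefix_reversals n) = n - 1"
  using card_image[OF prefix_reversal_inj_on, of n] by (auto simp: prefix_reversals_image)

text \<open>Ensures that, with at most \<open>n - 1\<close> vertices deleted, some vertex other than
  a given one survives.\<close>

lemma less_fact: "3 \<le> n \<Longrightarrow> n < fact n"
proof (induction n rule: nat_induct_at_least)
  case base
  then show ?case by (simp add: numeral_eq_Suc)
next
  case (Suc m)
  have "0 < m * fact m" using Suc.hyps by simp
  moreover have "fact (Suc m) = fact m + m * fact m" by simp
  ultimately show ?case using Suc.IH by linarith
qed

lemma card_Collect_permutes: "card {p. p permutes {1..n::nat}} = fact n"
  by (rule card_permutations) auto

text \<open>The prefix reversals are the neighbours of \<open>id\<close>: deleting them isolates
  \<open>id\<close>, while other vertices remain.\<close>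

lemma vertex_cut_prefix_reversals:
  assumes "3 \<le> n"
  shows "vertex_cut (pancake_graph n) (prefix_reversals n)"
proof -
  let ?P = "{p. p permutes {1..n}}"
  interpret pancake_deletion n "prefix_reversals n"
    by unfold_locales (simp add: prefix_reversals_image)
  have sub: "prefix_reversals n \<subseteq> ?P"
    using prefix_reversal_permutes by (auto simp: prefix_reversals_def)
  have id: "id \<in> verts G" using id_notin_prefix_reversals by (simp add: verts_G)
  have "card (insert id (prefix_reversals n)) = n"
    using card_prefix_reversals[of n] assms id_notin_prefix_reversals[of n] finite_D by simp
  then have "card (insert id (prefix_reversals n)) < card ?P"
    using less_fact[OF assms] card_Collect_permutes[of n] by simp
  then have "\<not> ?P \<subseteq> insert id (prefix_reversals n)"
    using finite_D card_mono[of "insert id (prefix_reversals n)" ?P] by auto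
  then obtain w where w: "w \<in> verts G" "w \<noteq> id" by (auto simp: verts_G)
  have "\<not> id \<rightarrow>\<^sup>*\<^bsub>G\<^esub> w"
  proof
    assume "id \<rightarrow>\<^sup>*\<^bsub>G\<^esub> w"
    then obtain z where "(id, z) \<in> arcs_ends G"
      using w(2) by (cases rule: converse_reachable_cases) auto
    then show False
      by (auto simp: delete_verts_def arcs_ends_induce_subgraph arcs_ends_pancake_graph
          prefix_reversals_def)
  qed
  then have "\<not> strongly_connected G" using id w by (auto simp: strongly_connected_def)
  then have "\<not> Digraph_Component.connected G"
    using symmetric_connected_imp_strongly_connected sym_arcs by blast
  then show ?thesis using sub id by (auto simp: vertex_cut_def verts_pancake_graph)
qed

theorem theorem2p5:
  fixes n :: nat
  assumes "n \<ge> 4"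
  shows "hyper_connected (pancake_graph n)"
  unfolding hyper_connected_def
proof (intro allI impI)
  fix D assume min: "min_vertex_cut (pancake_graph n) D"
  let ?P = "{p. p permutes {1..n}}"
  have cut: "D \<subseteq> ?P" "\<not> Digraph_Component.connected (delete_verts (pancake_graph n) D)"
    using min by (auto simp: min_vertex_cut_def vertex_cut_def verts_pancake_graph)
  have finP: "finite ?P" by (rule finite_permutations) simp
  interpret pancake_deletion n D
    using finite_subset[OF cut(1) finP] by unfold_locales
  have cardD: "card D \<le> n - 1"
    using min vertex_cut_prefix_reversals[of n] card_prefix_reversals[of n] assms
    by (auto simp: min_vertex_cut_def)
  obtain v where v: "linked (?P - {v})" using linked_except_one[OF assms cardD] by blast
  then have reach: "x \<rightarrow>\<^sup>*\<^bsub>G\<^esub> y" if "x \<in> verts G - {v}" "y \<in> verts G - {v}" for x y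
    using that by (auto simp: linked_def verts_G)
  have "card (insert v D) \<le> n" using card_insert_le_m1[of n D v] cardD assms by simp
  then have "card (insert v D) < card ?P"
    using less_fact[of n] card_Collect_permutes[of n] assms by simp
  then have "\<not> ?P \<subseteq> insert v D"
    using finite_D card_mono[of "insert v D" ?P] by auto
  then obtain w where w: "w \<in> verts G - {v}" by (auto simp: verts_G)
  have "\<not> strongly_connected G"
    using cut(2) strongly_connected_imp_connected wf_digraph by blast
  then obtain x y where xy: "x \<in> verts G" "y \<in> verts G" "\<not> x \<rightarrow>\<^sup>*\<^bsub>G\<^esub> y"
    using w by (auto simp: strongly_connected_def)
  \<comment> \<open>Otherwise \<open>reach\<close> would join \<open>x\<close> to
    \<open>y\<close>.\<close>
  have vG: "v \<in> verts G" using reach xy by blast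
  \<comment> \<open>A path between \<open>v\<close> and any other vertex would, with
    \<open>reach\<close>, make all of \<open>G\<close> mutually reachable, including
    \<open>x\<close> and \<open>y\<close>.\<close>
  have iso: "\<not> v \<rightarrow>\<^sup>*\<^bsub>G\<^esub> z" "\<not> z \<rightarrow>\<^sup>*\<^bsub>G\<^esub> v" if z: "z \<in> verts G - {v}" for z
  proof -
    show "\<not> v \<rightarrow>\<^sup>*\<^bsub>G\<^esub> z"
    proof
      assume vz: "v \<rightarrow>\<^sup>*\<^bsub>G\<^esub> z"
      have "u \<rightarrow>\<^sup>*\<^bsub>G\<^esub> z" if "u \<in> verts G" for u using vz reach[of u z] z that by auto
      then have "x \<rightarrow>\<^sup>*\<^bsub>G\<^esub> z" "y \<rightarrow>\<^sup>*\<^bsub>G\<^esub> z" using xy by auto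
      then show False using xy(3) symmetric_reachable' reachable_trans by blast
    qed
    then show "\<not> z \<rightarrow>\<^sup>*\<^bsub>G\<^esub> v" using symmetric_reachable' by blast
  qed
  have scc_v: "scc_of v = {v}"
    using iso vG by (auto simp: scc_of_def dest: reachable_in_verts)
  have scc_z: "scc_of z = verts G - {v}" if "z \<in> verts G - {v}" for z
    using iso[OF that] reach that by (auto simp: scc_of_def dest: reachable_in_verts)
  have "scc_of ` verts G = {{v}, verts G - {v}}"
    using scc_v scc_z vG w by (auto simp: image_iff)
  then have verts: "sccs_verts = {{v}, verts G - {v}}"
    by (simp add: sccs_verts_conv_scc_of)
  have "{v} \<noteq> verts G - {v}" by auto
  then have "card (components G) = 2"
    using card_sccs_verts verts components_symmetric[OF sym_digraph_G] by simp
  moreover have "G \<restriction> {v} \<in> components G"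
    using in_sccs_verts_conv[of "{v}"] verts components_symmetric[OF sym_digraph_G] by simp
  moreover have "verts (G \<restriction> {v}) = {v}" by simp
  ultimately show "card (components G) = 2 \<and> (\<exists>C\<in>components G. \<exists>v. verts C = {v})"
    by blast
qed

end
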